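(* For every integer $n \ge 1$, let $f(n)$ be the maximum, over all cyclic permutations $\pi$ of order $n$, of the minimum number of adjacent swaps needed to transform $\pi$ into the trivial cyclic permutation $u=(1,2,\ldots,n)$. Then \[ f(n) \ge \left\lfloor \frac{(n-1)^2}{4} \right\rfloor. \]
   Context: A cyclic permutation of order $n$ is a bijective labeling of the vertices of a cycle of length $n$ by the elements of $[n]=\{1,\ldots,n\}$, where two labelings that differ by a rotation of the cycle (a cyclic shift) are considered the same; reflections are not identified. An adjacent swap transforms a cyclic permutation into the one obtained by exchanging the labels of two vertices that are adjacent along the cycle. The trivial cyclic permutation $u=(1,2,\ldots,n)$ is the labeling in which the labels $1,2,\ldots,n$ appear consecutively around the cycle in this order. *)

theory Defs
  imports Complex_Main "HOL-Combinatorics.Multiset_Permutations"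
begin

text \<open>
  The cycle of length \<open>n\<close> has vertices \<open>0, \<dots>, n - 1\<close>, with \<open>i\<close> adjacent to \<open>Suc i mod n\<close>.
  A bijective labeling by \<open>{1..n}\<close> is the list of its labels, and a cyclic permutation is
  the class of such a list under rotation.
\<close>

definition labelings :: "nat \<Rightarrow> nat list set" where
  "labelings n = permutations_of_set {1..n}"

definition rotation_rel :: "nat \<Rightarrow> (nat list \<times> nat list) set" where
  "rotation_rel n = {(xs, ys). xs \<in> labelings n \<and> ys \<in> labelings n \<and> (\<exists>k. ys = rotate k xs)}"

definition cyclic_permutations :: "nat \<Rightarrow> nat list set set" where
  "cyclic_permutations n = labelings n // rotation_rel n"

definition trivial_cyclic_permutation :: "nat \<Rightarrow> nat list set" where
  "trivial_cyclic_permutation n = rotation_rel n `` {[1..<Suc n]}"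

definition swap_labels :: "nat \<Rightarrow> nat \<Rightarrow> 'a list \<Rightarrow> 'a list" where
  "swap_labels i j xs = xs[i := xs ! j, j := xs ! i]"

text \<open>
  The condition \<open>i \<noteq> Suc i mod n\<close> only matters for \<open>n = 1\<close>, where the cycle has no two
  adjacent vertices and hence admits no swap.
\<close>

definition adjacent_swap_rel :: "nat \<Rightarrow> (nat list set \<times> nat list set) set" where
  "adjacent_swap_rel n = {(A, B). A \<in> cyclic_permutations n \<and>
     (\<exists>xs\<in>A. \<exists>i<n. i \<noteq> Suc i mod n \<and> B = rotation_rel n `` {swap_labels i (Suc i mod n) xs})}"

definition swap_number :: "nat \<Rightarrow> nat list set \<Rightarrow> nat" where
  "swap_number n A = (LEAST k. (A, trivial_cyclic_permutation n) \<in> adjacent_swap_rel n ^^ k)"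

definition max_swap_number :: "nat \<Rightarrow> nat" where
  "max_swap_number n = Max (swap_number n ` cyclic_permutations n)"

text \<open>
  The remaining facts show that the notions above are well defined: rotation is an equivalence,
  the maximum ranges over a finite nonempty set, and the trivial cyclic permutation is always
  reachable, so that the \<open>LEAST\<close> is attained.
\<close>

lemma length_labelings: "xs \<in> labelings n \<Longrightarrow> length xs = n"
  by (simp add: labelings_def length_finite_permutations_of_set)

lemma rotate_labelings: "xs \<in> labelings n \<Longrightarrow> rotate k xs \<in> labelings n"
  by (simp add: labelings_def permutations_of_set_def)

lemma equiv_rotation_rel: "equiv (labelings n) (rotation_rel n)"
proof (rule equivI)
  show "rotation_rel n \<subseteq> labelings n \<times> labelings n"
    by (auto simp: rotation_rel_def)
  show "refl_on (labelings n) (rotation_rel n)"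
    by (auto simp: refl_on_def rotation_rel_def intro: exI[of _ 0])
  show "sym (rotation_rel n)"
  proof (rule symI)
    fix xs ys assume "(xs, ys) \<in> rotation_rel n"
    then obtain k where k: "xs \<in> labelings n" "ys \<in> labelings n" "ys = rotate k xs"
      by (auto simp: rotation_rel_def)
    have "rotate (length xs - k mod length xs) (rotate (k mod length xs) xs) = xs"
      by (cases "xs = []") (simp_all add: rotate_rotate less_imp_le rotate_id)
    then show "(ys, xs) \<in> rotation_rel n"
      using k unfolding rotation_rel_def by (auto simp: rotate_conv_mod[of k] intro!: sym)
  qed
  show "trans (rotation_rel n)"
    by (rule transI) (auto simp: rotation_rel_def rotate_rotate)
qed

lemma upt_labelings: "[1..<Suc n] \<in> labelings n"
  unfolding labelings_def by (rule permutations_of_setI) auto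

lemma trivial_in_cyclic_permutations: "trivial_cyclic_permutation n \<in> cyclic_permutations n"
  unfolding trivial_cyclic_permutation_def cyclic_permutations_def
  by (rule quotientI) (rule upt_labelings)

lemma finite_cyclic_permutations: "finite (cyclic_permutations n)"
  unfolding cyclic_permutations_def
  by (rule finite_quotient) (auto simp: labelings_def rotation_rel_def)

lemma class_swap_step:
  assumes "p @ a # b # q \<in> labelings n"
  shows "(rotation_rel n `` {p @ a # b # q}, rotation_rel n `` {p @ b # a # q}) \<in> adjacent_swap_rel n"
proof -
  let ?xs = "p @ a # b # q" and ?i = "length p"
  have n: "n = length p + 2 + length q"
    using length_labelings[OF assms] by simp
  have "swap_labels ?i (Suc ?i mod n) ?xs = p @ b # a # q"
    by (simp add: n swap_labels_def nth_append list_update_append)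
  moreover have "?xs \<in> rotation_rel n `` {?xs}"
    using equiv_class_self[OF equiv_rotation_rel assms] .
  moreover have "rotation_rel n `` {?xs} \<in> cyclic_permutations n"
    unfolding cyclic_permutations_def using assms by (rule quotientI)
  moreover have "?i < n" "?i \<noteq> Suc ?i mod n"
    by (simp_all add: n)
  ultimately show ?thesis
    unfolding adjacent_swap_rel_def mem_Collect_eq case_prod_conv by metis
qed

lemma mset_labelings: "xs \<in> labelings n \<Longrightarrow> mset xs = mset ys \<Longrightarrow> ys \<in> labelings n"
  unfolding labelings_def permutations_of_set_def
  by (metis (mono_tags, lifting) mem_Collect_eq mset_eq_imp_distinct_iff mset_eq_setD)

lemma move_front_reachable:
  assumes "p @ us @ a # vs \<in> labelings n"
  shows "(rotation_rel n `` {p @ us @ a # vs}, rotation_rel n `` {p @ a # us @ vs})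
    \<in> (adjacent_swap_rel n)\<^sup>*"
  using assms
proof (induction us arbitrary: vs rule: rev_induct)
  case (snoc u us)
  have 1: "(p @ us) @ u # a # vs \<in> labelings n" using snoc.prems by simp
  have 2: "p @ us @ a # u # vs \<in> labelings n"
    by (rule mset_labelings[OF snoc.prems]) simp
  show ?case
    using converse_rtrancl_into_rtrancl[OF class_swap_step[OF 1]] snoc.IH[OF 2] by simp
qed simp

lemma mset_reachable:
  assumes "p @ xs \<in> labelings n" "mset xs = mset ys"
  shows "(rotation_rel n `` {p @ xs}, rotation_rel n `` {p @ ys}) \<in> (adjacent_swap_rel n)\<^sup>*"
  using assms
proof (induction ys arbitrary: p xs)
  case (Cons y ys)
  then have "y \<in> set xs"
    by (metis list.set_intros(1) mset_eq_setD)
  then obtain us vs where xs: "xs = us @ y # vs"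
    by (meson split_list)
  have l: "(p @ [y]) @ us @ vs \<in> labelings n"
    by (rule mset_labelings[OF Cons.prems(1)]) (simp add: xs)
  have m: "mset (us @ vs) = mset ys"
    using Cons.prems(2) by (simp add: xs)
  show ?case
    using move_front_reachable[of p us y vs n] Cons.prems(1) Cons.IH[OF l m]
    by (simp add: xs)
qed simp

lemma trivial_reachable:
  assumes "A \<in> cyclic_permutations n"
  shows "\<exists>k. (A, trivial_cyclic_permutation n) \<in> adjacent_swap_rel n ^^ k"
proof -
  obtain xs where xs: "xs \<in> labelings n" "A = rotation_rel n `` {xs}"
    using assms unfolding cyclic_permutations_def by (rule quotientE)
  have "mset xs = mset [1..<Suc n]"
    using xs(1) upt_labelings[of n] unfolding labelings_def permutations_of_set_def
    by (metis (mono_tags, lifting) mem_Collect_eq set_eq_iff_mset_eq_distinct)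
  then have "(A, trivial_cyclic_permutation n) \<in> (adjacent_swap_rel n)\<^sup>*"
    using mset_reachable[of "[]" xs n "[1..<Suc n]"] xs
    unfolding trivial_cyclic_permutation_def by simp
  then show ?thesis by (simp add: rtrancl_power)
qed

end

theory Submission
  imports Defs
begin

text \<open>
  Rotating a labeling by one place reverses the relative order of the moved label with every other
  label, whereas an adjacent swap reverses the relative order of a single pair. Hence, modulo cuts
  of the complete graph on the labels, \<open>k\<close> swaps change the set of inverted pairs in at most
  \<open>k\<close> edges. For the reversed labeling all pairs are inverted, and the complement of a cut
  consists of two cliques on \<open>p + q = n\<close> vertices, which have at least
  \<open>\<lfloor>(n - 1)\<^sup>2 / 4\<rfloor>\<close> edges in total.
\<close>

text \<open>
  The colouring \<open>c\<close> encodes a cut; the pairs counted are those in the symmetric difference of the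
  cut with the set of inverted pairs.
\<close>

fun discrepancy :: "('a::linorder \<Rightarrow> bool) \<Rightarrow> 'a list \<Rightarrow> nat" where
  "discrepancy c [] = 0"
| "discrepancy c (x # xs) =
     length (filter (\<lambda>y. (x < y) \<noteq> (c x = c y)) xs) + discrepancy c xs"

lemma discrepancy_snoc:
  "discrepancy c (xs @ [x]) =
     discrepancy c xs + length (filter (\<lambda>y. (y < x) \<noteq> (c y = c x)) xs)"
  by (induction xs) auto

lemma discrepancy_cong:
  assumes "\<And>x. x \<in> set xs \<Longrightarrow> c x = c' x"
  shows "discrepancy c xs = discrepancy c' xs"
  using assms
proof (induction xs)
  case (Cons x xs)
  have "filter (\<lambda>y. (x < y) \<noteq> (c x = c y)) xs = filter (\<lambda>y. (x < y) \<noteq> (c' x = c' y)) xs"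
    using Cons.prems by (intro filter_cong) auto
  with Cons show ?case by simp
qed simp

text \<open>Moving \<open>x\<close> from front to back reverses its order relative to every other
  label, and flipping its colour changes which labels agree with it in colour. The two effects
  cancel for each pair containing \<open>x\<close>, and no other pair is affected.\<close>

lemma discrepancy_rotate1:
  assumes "distinct (x # xs)"
  shows "discrepancy (c(x := \<not> c x)) (xs @ [x]) = discrepancy c (x # xs)"
proof -
  have "filter (\<lambda>y. (y < x) \<noteq> ((c(x := \<not> c x)) y = (c(x := \<not> c x)) x)) xs
      = filter (\<lambda>y. (x < y) \<noteq> (c x = c y)) xs"
    using assms by (intro filter_cong) auto
  moreover have "discrepancy (c(x := \<not> c x)) xs = discrepancy c xs"
    using assms by (intro discrepancy_cong) auto
  ultimately show ?thesis
    by (simp add: discrepancy_snoc)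
qed

lemma discrepancy_rotate:
  assumes "distinct xs"
  shows "\<exists>c'. discrepancy c' (rotate k xs) = discrepancy c xs"
proof (induction k)
  case 0
  show ?case by auto
next
  case (Suc k)
  then obtain c' where c': "discrepancy c' (rotate k xs) = discrepancy c xs"
    by blast
  show ?case
  proof (cases "rotate k xs")
    case Nil
    then show ?thesis using c' by (auto simp: rotate_Suc)
  next
    case (Cons y ys)
    then have "distinct (y # ys)" using assms by (metis distinct_rotate)
    from discrepancy_rotate1[OF this, of c'] show ?thesis
      using c' Cons by (auto simp: rotate_Suc)
  qed
qed

text \<open>Only the pair of \<open>a\<close> and \<open>b\<close> changes its relative order, so
  all other contributions agree.\<close>

lemma discrepancy_swap: "discrepancy c (a # b # xs) \<le> Suc (discrepancy c (b # a # xs))"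
  by simp

text \<open>One common rotation brings the two swapped vertices to the front. The edge joining the
  last vertex to the first thus needs no separate treatment later.\<close>

lemma adjacent_swap_rotate:
  assumes "length xs = n" "i < n" "i \<noteq> Suc i mod n"
  obtains a b q where "rotate i xs = a # b # q"
    "rotate i (swap_labels i (Suc i mod n) xs) = b # a # q"
proof (cases "Suc i < n")
  case True
  define p a b q where "p = take i xs" and "a = xs ! i" and "b = xs ! Suc i"
    and "q = drop (Suc (Suc i)) xs"
  have xs: "xs = p @ a # b # q" and p: "length p = i"
    using True assms by (simp_all add: p_def a_def b_def q_def Cons_nth_drop_Suc)
  have "swap_labels i (Suc i mod n) xs = p @ b # a # q"
    using True p by (simp add: xs swap_labels_def nth_append list_update_append)
  with that[of a b "q @ p"] xs p rotate_append[of p "a # b # q"] rotate_append[of p "b # a # q"]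
  show thesis by simp
next
  case False
  then have n: "n = Suc i" using assms by simp
  \<comment> \<open>For \<open>i = 0\<close> there would be a single vertex, which the third
    assumption excludes.\<close>
  then have "i > 0" using assms(3) by (cases i) simp_all
  obtain b r where br: "xs = b # r" "length r = i" using assms n by (cases xs) auto
  with \<open>i > 0\<close> obtain p a where xs: "xs = b # p @ [a]"
    by (metis length_greater_0_conv rev_exhaust)
  then have p: "i = Suc (length p)" using br by simp
  have "swap_labels i (Suc i mod n) xs = a # p @ [b]"
    using n p by (simp add: xs swap_labels_def nth_append list_update_append)
  with that[of a b p] xs p rotate_append[of "b # p" "[a]"] rotate_append[of "a # p" "[b]"]
  show thesis by simp
qed

text \<open>Changing the representative of a class changes the colouring, so the induction on
  \<open>k\<close> carries an existential over \<open>c\<close> and ranges over all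
  representatives.\<close>

lemma discrepancy_le_swaps:
  assumes "(A, trivial_cyclic_permutation n) \<in> adjacent_swap_rel n ^^ k" "xs \<in> A"
  shows "\<exists>c. discrepancy c xs \<le> k"
  using assms
proof (induction k arbitrary: A xs)
  case 0
  \<comment> \<open>A constant colouring gives the empty cut, so only inverted pairs count, and an
    increasing list has none.\<close>
  have "discrepancy (\<lambda>_. True) ys = 0" if "sorted_wrt (<) ys" for ys :: "nat list"
    using that by (induction ys) auto
  then have "discrepancy (\<lambda>_. True) [1..<Suc n] = 0"
    using sorted_wrt_upt by blast
  moreover obtain j where "xs = rotate j [1..<Suc n]"
    using 0 by (auto simp: trivial_cyclic_permutation_def rotation_rel_def)
  ultimately show ?case
    using discrepancy_rotate[of "[1..<Suc n]" j "\<lambda>_. True"]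
    by (metis distinct_upt order_refl)
next
  case (Suc k)
  from Suc.prems(1) obtain B where AB: "(A, B) \<in> adjacent_swap_rel n"
    and B: "(B, trivial_cyclic_permutation n) \<in> adjacent_swap_rel n ^^ k"
    by (meson relpow_Suc_D2)
  from AB obtain ys i where A: "A \<in> cyclic_permutations n" and ys: "ys \<in> A"
    and i: "i < n" "i \<noteq> Suc i mod n"
    and B_eq: "B = rotation_rel n `` {swap_labels i (Suc i mod n) ys}"
    by (auto simp: adjacent_swap_rel_def)
  let ?zs = "swap_labels i (Suc i mod n) ys"
  have rel: "(rotate i ys, xs) \<in> rotation_rel n" and ys_lab: "ys \<in> labelings n"
  proof -
    have yx: "(ys, xs) \<in> rotation_rel n"
      using A ys Suc.prems(2) quotient_eq_iff[OF equiv_rotation_rel]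
      unfolding cyclic_permutations_def by blast
    then show "ys \<in> labelings n" by (simp add: rotation_rel_def)
    then have "(ys, rotate i ys) \<in> rotation_rel n"
      by (auto simp: rotation_rel_def rotate_labelings)
    with yx show "(rotate i ys, xs) \<in> rotation_rel n"
      using equiv_rotation_rel[of n] by (meson equivE symD transD)
  qed
  obtain a b q where q: "rotate i ys = a # b # q" "rotate i ?zs = b # a # q"
    using adjacent_swap_rotate[OF length_labelings[OF ys_lab] i] by metis
  have "mset ys = mset ?zs"
    using i length_labelings[OF ys_lab] by (simp add: swap_labels_def mset_swap)
  then have zs_lab: "?zs \<in> labelings n"
    by (rule mset_labelings[OF ys_lab])
  then have "?zs \<in> B"
    unfolding B_eq by (rule equiv_class_self[OF equiv_rotation_rel])
  then obtain c where "discrepancy c ?zs \<le> k"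
    using Suc.IH[OF B] by blast
  moreover have "distinct ?zs"
    using zs_lab by (simp add: labelings_def permutations_of_set_def)
  \<comment> \<open>Recolouring along the rotation by \<open>i\<close> moves the bound from
    \<open>?zs\<close> to the list with the swapped labels in front.\<close>
  ultimately obtain c' where "discrepancy c' (b # a # q) \<le> k"
    using discrepancy_rotate[of ?zs i c] q by metis
  then have "discrepancy c' (rotate i ys) \<le> Suc k"
    using discrepancy_swap[of c' a b q] q by simp
  moreover obtain j where "xs = rotate j (rotate i ys)"
    using rel by (auto simp: rotation_rel_def)
  moreover have "distinct (rotate i ys)"
    using ys_lab by (simp add: labelings_def permutations_of_set_def)
  ultimately show ?case
    using discrepancy_rotate by metis
qed

text \<open>All pairs are inverted, so the pairs counted are the monochromatic ones. A colour class
  of size \<open>m\<close> has \<open>m * (m - 1) / 2\<close> of them; doubling and adding the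
  length avoids division and subtraction.\<close>

lemma discrepancy_decreasing:
  assumes "sorted_wrt (>) xs"
  shows "2 * discrepancy c xs + length xs =
    (length (filter c xs))\<^sup>2 + (length (filter (\<lambda>x. \<not> c x) xs))\<^sup>2"
  using assms
proof (induction xs)
  case (Cons x xs)
  have "filter (\<lambda>y. (x < y) \<noteq> (c x = c y)) xs = filter (\<lambda>y. c x = c y) xs"
    using Cons.prems by (intro filter_cong) auto
  with Cons show ?case
    by (cases "c x") (simp_all add: power2_eq_square)
qed simp

theorem theorem2p2:
  fixes n :: nat
  assumes "n \<ge> 1"
  shows "int (max_swap_number n) \<ge> \<lfloor>(real n - 1)\<^sup>2 / 4\<rfloor>"
proof -
  define xs where "xs = rev [1..<Suc n]"
  define A where "A = rotation_rel n `` {xs}"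
  define k where "k = swap_number n A"
  have lab: "xs \<in> labelings n"
    unfolding xs_def by (rule mset_labelings[OF upt_labelings]) simp
  then have A: "A \<in> cyclic_permutations n"
    unfolding A_def cyclic_permutations_def by (rule quotientI)
  have "(A, trivial_cyclic_permutation n) \<in> adjacent_swap_rel n ^^ k"
    unfolding k_def swap_number_def using trivial_reachable[OF A] by (rule LeastI_ex)
  moreover have "xs \<in> A"
    unfolding A_def by (rule equiv_class_self[OF equiv_rotation_rel lab])
  ultimately obtain c where c: "discrepancy c xs \<le> k"
    using discrepancy_le_swaps by blast
  define p q where "p = length (filter c xs)" and "q = length (filter (\<lambda>x. \<not> c x) xs)"
  have pq: "n = p + q"
    using sum_length_filter_compl[of c xs] by (simp add: p_def q_def xs_def)
  have "sorted_wrt (>) xs"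
    by (simp add: xs_def sorted_wrt_rev del: upt_Suc)
  from discrepancy_decreasing[OF this, of c] have "2 * discrepancy c xs + n = p\<^sup>2 + q\<^sup>2"
    using length_labelings[OF lab] by (simp add: p_def q_def)
  then have "p\<^sup>2 + q\<^sup>2 \<le> 2 * k + n"
    using c by linarith
  then have "real (p\<^sup>2 + q\<^sup>2) \<le> real (2 * k + n)"
    by (rule of_nat_mono)
  moreover have "(real n)\<^sup>2 \<le> 2 * ((real p)\<^sup>2 + (real q)\<^sup>2)"
    using zero_le_power2[of "real p - real q"] pq by (simp add: power2_eq_square algebra_simps)
  \<comment> \<open>Together the bounds give \<open>n * n \<le> 4 * k + 2 * n\<close>, so the square
    of \<open>n - 1\<close> is at most \<open>4 * k + 1\<close>; the floor absorbs the excess of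
    1/4.\<close>
  ultimately have "(real n - 1)\<^sup>2 / 4 < real k + 1"
    by (simp add: power2_eq_square algebra_simps)
  then have "\<lfloor>(real n - 1)\<^sup>2 / 4\<rfloor> \<le> int k"
    by linarith
  moreover have "k \<le> max_swap_number n"
    unfolding max_swap_number_def k_def
    using A finite_cyclic_permutations by (intro Max_ge) auto
  ultimately show ?thesis
    by linarith
qed

end
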